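(* For all $\epsilon>0$ and $t\in\mathbb{N}$ there exists $d_0\in\mathbb{N}$ such that for every $d\ge d_0$ there exists $n_0\in\mathbb{N}$ such that for all $n\ge n_0$, every $n$-vertex graph $G$ of average degree $d$ containing no subgraph isomorphic to $K_{t,t,t}$ satisfies \[\alpha(G)\ge(1-\epsilon)\frac{n\log d}{d}.\]
   Context: $\alpha(G)$ is the independence number; $K_{t,t,t}$ is the complete tripartite graph with three parts of size $t$; subgraphs need not be induced. $\log$ is the natural logarithm. *)

theory Defs
  imports Complex_Main
    "Graph_Theory.Pair_Digraph"
    "Graph_Theory.Digraph_Component"
    "Graph_Theory.Digraph_Isomorphism"
begin

text \<open>
  Finite simple graphs are the symmetric loop-free digraphs of the locale \<open>pair_graph\<close>: an edge
  \<open>{u, v}\<close> is the pair of arcs \<open>(u, v)\<close>, \<open>(v, u)\<close>. The out-degree of a vertex is therefore its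
  usual degree.
\<close>

definition average_degree :: "('a, 'b) pre_digraph \<Rightarrow> real" where
  "average_degree G = (\<Sum>v\<in>verts G. real (out_degree G v)) / real (card (verts G))"

definition independent_set :: "('a, 'b) pre_digraph \<Rightarrow> 'a set \<Rightarrow> bool" where
  "independent_set G S \<longleftrightarrow> S \<subseteq> verts G \<and> (\<forall>u\<in>S. \<forall>v\<in>S. (u, v) \<notin> arcs_ends G)"

definition independence_number :: "('a, 'b) pre_digraph \<Rightarrow> nat" (\<open>\<alpha>\<close>) where
  "\<alpha> G = Max {card S | S. independent_set G S}"

text \<open>The parts of \<open>K\<^bsub>t,t,t\<^esub>\<close> are \<open>{i} \<times> {..<t}\<close> for \<open>i < 3\<close>.\<close>

definition complete_tripartite_graph :: "nat \<Rightarrow> (nat \<times> nat) pair_pre_digraph" where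
  "complete_tripartite_graph t =
     \<lparr> pverts = {..<3} \<times> {..<t},
       parcs = {(u, v). u \<in> {..<3} \<times> {..<t} \<and> v \<in> {..<3} \<times> {..<t} \<and> fst u \<noteq> fst v} \<rparr>"

text \<open>Subgraphs need not be induced.\<close>

definition contains_copy :: "('a, 'b) pre_digraph \<Rightarrow> ('c, 'd) pre_digraph \<Rightarrow> bool" where
  "contains_copy G F \<longleftrightarrow> (\<exists>H. subgraph H G \<and> digraph_iso H F)"

end

theory Submission
  imports Defs "HOL-Analysis.Derivative" "HOL-Real_Asymp.Real_Asymp"
begin

text \<open>
  Shearer's induction on the number of vertices: \<open>\<alpha> \<ge> n f(d)\<close> for \<open>f(x) = c ln(1 + x/A) / x\<close> with
  \<open>c < 1\<close>, a positive, decreasing and convex function, so that a deletion that changes the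
  average degree from \<open>d\<close> to \<open>d'\<close> can be estimated through \<open>f(d') \<ge> f(d) + (d' - d) f'(d)\<close>.
  If \<open>d\<close> is small compared to \<open>A\<close>, a maximal independent set among the vertices of degree at most
  \<open>2d\<close> suffices. A vertex of degree at least \<open>d powr (1 + \<eta>)\<close> can be deleted, because this decreases
  the average degree enough to compensate for the lost vertex. Otherwise one takes a vertex
  \<open>v\<close> into the independent set and deletes its closed neighbourhood. On average over \<open>v\<close>, the induction
  goes through up to an error of order \<open>h ln d / d\<^sup>2\<close>, where \<open>h\<close> is the average number of arcs inside a
  neighbourhood. Since the maximum degree \<open>\<Delta>\<close> is at most \<open>d powr (1 + \<eta>)\<close> and the graph is
  \<open>K\<^bsub>t,t,t\<^esub>\<close>-free, \<open>h = O(\<Delta> powr (2 - 1/t\<^sup>2))\<close> is a power of \<open>d\<close> below \<open>d\<^sup>2\<close>. The three steps apply to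
  graphs of any order, so \<open>n\<^sub>0 = 0\<close> works.
\<close>

section \<open>Power means and binomial coefficients\<close>

text \<open>Jensen's inequality for the convex function \<open>x ^ Suc k\<close> with equal weights,
  cleared of denominators; the exponent is \<open>Suc k\<close> because one factor of the
  cardinality cancels.\<close>

lemma power_sum_le_card_times_sum_power:
  fixes a :: "'i \<Rightarrow> real"
  assumes "finite P" "\<And>x. x \<in> P \<Longrightarrow> 0 \<le> a x"
  shows "(\<Sum>x\<in>P. a x) ^ Suc k \<le> real (card P) ^ k * (\<Sum>x\<in>P. a x ^ Suc k)"
proof (cases "P = {}")
  case False
  define N where "N = real (card P)"
  have N: "N > 0"
    using assms(1) False by (simp add: N_def card_gt_0_iff)
  have conv: "convex_on {0::real..} (\<lambda>x. x ^ Suc k)"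
    using convex_power_odd[of "Suc k"] convex_on_subset[OF convex_power_even[of "Suc k"], of "{0..}"]
    by (cases "even (Suc k)") auto
  have "(\<Sum>x\<in>P. (1 / N) *\<^sub>R a x) ^ Suc k \<le> (\<Sum>x\<in>P. (1 / N) * a x ^ Suc k)"
    by (rule convex_on_sum[OF assms(1) False conv]) (use assms N in \<open>auto simp: N_def\<close>)
  then have "(\<Sum>x\<in>P. a x) ^ Suc k / N ^ Suc k \<le> (\<Sum>x\<in>P. a x ^ Suc k) / N"
    by (simp add: sum_divide_distrib[symmetric] power_divide del: power_Suc)
  then have "(\<Sum>x\<in>P. a x) ^ Suc k \<le> (\<Sum>x\<in>P. a x ^ Suc k) / N * N ^ Suc k"
    using N by (simp add: pos_divide_le_eq del: power_Suc)
  then show ?thesis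
    using N unfolding N_def[symmetric] by (simp add: field_simps)
qed simp

text \<open>For \<open>t \<le> c\<close> this is the bound (c/t)^t on the binomial coefficient. The
  summand 1 covers \<open>c < t\<close>, where the coefficient vanishes.\<close>

lemma power_le_binomial:
  assumes "0 < t"
  shows "real c ^ t \<le> real t ^ t * (real (c choose t) + 1)"
proof (cases "t \<le> c")
  case True
  have "(real c / real t) ^ t \<le> real (c choose t)"
    using binomial_ge_n_over_k_pow_k[OF True, where 'a=real] by simp
  then have "real c ^ t \<le> real t ^ t * real (c choose t)"
    using assms by (simp add: power_divide divide_le_eq mult.commute)
  also have "\<dots> \<le> real t ^ t * (real (c choose t) + 1)"
    by (intro mult_left_mono) auto
  finally show ?thesis .
next
  case False
  then have "real c ^ t \<le> real t ^ t"
    by (intro power_mono) auto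
  also have "\<dots> \<le> real t ^ t * (real (c choose t) + 1)"
    by (simp add: algebra_simps)
  finally show ?thesis .
qed

text \<open>The convexity step of the double counting arguments. The average is taken over a bound
  \<open>p\<close> on the number of indices, so that crude counts such as n times a degree bound can
  be inserted.\<close>

lemma average_power_le_average_binomial:
  fixes c :: "'i \<Rightarrow> nat"
  assumes "finite P" "real (card P) \<le> p" "0 < p" "0 < t"
  shows "(real (\<Sum>x\<in>P. c x) / p) ^ t \<le> real t ^ t * (real (\<Sum>x\<in>P. c x choose t) / p + 1)"
proof -
  obtain k where t: "t = Suc k"
    using assms(4) gr0_conv_Suc by blast
  have "real (\<Sum>x\<in>P. c x) ^ t \<le> real (card P) ^ k * (\<Sum>x\<in>P. real (c x) ^ t)"
    using power_sum_le_card_times_sum_power[OF assms(1), of "\<lambda>x. real (c x)" k] by (simp add: t)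
  also have "\<dots> \<le> p ^ k * (\<Sum>x\<in>P. real t ^ t * (real (c x choose t) + 1))"
    using assms power_le_binomial by (intro mult_mono power_mono sum_mono sum_nonneg) auto
  also have "\<dots> = p ^ k * (real t ^ t * (real (\<Sum>x\<in>P. c x choose t) + real (card P)))"
    by (simp add: sum_distrib_left[symmetric] sum.distrib)
  also have "\<dots> \<le> p ^ k * (real t ^ t * (real (\<Sum>x\<in>P. c x choose t) + p))"
    using assms by (intro mult_left_mono) auto
  finally have "real (\<Sum>x\<in>P. c x) ^ t / p ^ t
      \<le> p ^ k * (real t ^ t * (real (\<Sum>x\<in>P. c x choose t) + p)) / p ^ t"
    using assms by (intro divide_right_mono) auto
  then show ?thesis
    using assms(3) by (simp add: t power_divide field_simps)
qed

lemma card_Sigma_subsets: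
  assumes "finite P" "\<And>x. x \<in> P \<Longrightarrow> finite (R x)"
  shows "card (SIGMA x:P. {T. T \<subseteq> R x \<and> card T = t}) = (\<Sum>x\<in>P. card (R x) choose t)"
  using assms by (subst card_SigmaI) (auto simp: n_subsets)

section \<open>Induced subgraphs of a fixed graph\<close>

text \<open>The relation is fixed once and for all; an induced subgraph is represented by its vertex
  set alone, which lets the induction run over finite sets.\<close>

locale adjacency =
  fixes adj :: "'a \<Rightarrow> 'a \<Rightarrow> bool"
  assumes adj_sym: "adj u v \<Longrightarrow> adj v u"
    and adj_irrefl: "\<not> adj v v"
begin

definition nbrs :: "'a set \<Rightarrow> 'a \<Rightarrow> 'a set" where
  "nbrs V v = {w \<in> V. adj v w}"

definition arcs_from_to :: "'a set \<Rightarrow> 'a set \<Rightarrow> nat" where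
  "arcs_from_to X Y = (\<Sum>x\<in>X. card (nbrs Y x))"

text \<open>Arcs are ordered pairs, so for finite \<open>V\<close> this is twice the number of edges
  of the subgraph induced by \<open>V\<close>.\<close>

definition degree_sum :: "'a set \<Rightarrow> nat" where
  "degree_sum V = arcs_from_to V V"

text \<open>For finite \<open>V\<close> every triangle is counted six times, once for each ordering
  of its vertices.\<close>

definition triangle_sum :: "'a set \<Rightarrow> nat" where
  "triangle_sum V = (\<Sum>v\<in>V. degree_sum (nbrs V v))"

definition indep :: "'a set \<Rightarrow> bool" where
  "indep S \<longleftrightarrow> (\<forall>u\<in>S. \<forall>v\<in>S. \<not> adj u v)"

definition complete_between :: "'a set \<Rightarrow> 'a set \<Rightarrow> bool" where
  "complete_between A B \<longleftrightarrow> (\<forall>a\<in>A. \<forall>b\<in>B. adj a b)"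

text \<open>Disjointness of the three parts is implied: a common vertex of two of them would be
  adjacent to itself.\<close>

definition tripartite_free :: "nat \<Rightarrow> 'a set \<Rightarrow> bool" where
  "tripartite_free t V \<longleftrightarrow>
     (\<forall>A B C. A \<subseteq> V \<longrightarrow> B \<subseteq> V \<longrightarrow> C \<subseteq> V \<longrightarrow> card A = t \<longrightarrow> card B = t \<longrightarrow> card C = t \<longrightarrow>
        complete_between A B \<longrightarrow> complete_between A C \<longrightarrow> complete_between B C \<longrightarrow> False)"

lemmas tripartite_freeD = tripartite_free_def[THEN iffD1, rule_format]

lemma tripartite_free_subset:
  assumes "tripartite_free t V" "U \<subseteq> V"
  shows "tripartite_free t U"
  unfolding tripartite_free_def
proof (intro allI impI)
  fix A B C
  assume sub: "A \<subseteq> U" "B \<subseteq> U" "C \<subseteq> U"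
    and *: "card A = t" "card B = t" "card C = t"
      "complete_between A B" "complete_between A C" "complete_between B C"
  show False
    by (rule tripartite_freeD[OF assms(1) sub[THEN subset_trans[OF _ assms(2)]] *])
qed

lemma finite_nbrs [simp]: "finite V \<Longrightarrow> finite (nbrs V v)"
  by (simp add: nbrs_def)

lemma nbrs_subset: "nbrs V v \<subseteq> V"
  by (auto simp: nbrs_def)

lemma arcs_from_to_commute:
  assumes "finite X" "finite Y"
  shows "arcs_from_to X Y = arcs_from_to Y X"
proof -
  have *: "arcs_from_to X Y = (\<Sum>x\<in>X. \<Sum>y\<in>Y. of_bool (adj x y))" if "finite Y" for X Y
    using that by (simp add: arcs_from_to_def nbrs_def Int_def)
  have "(\<Sum>x\<in>X. \<Sum>y\<in>Y. of_bool (adj x y) :: nat) = (\<Sum>y\<in>Y. \<Sum>x\<in>X. of_bool (adj x y))"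
    by (rule sum.swap)
  also have "\<dots> = (\<Sum>y\<in>Y. \<Sum>x\<in>X. of_bool (adj y x))"
    by (intro sum.cong refl) (use adj_sym in auto)
  finally show ?thesis
    using assms by (simp add: *)
qed

lemma arcs_from_to_split_left:
  assumes "finite X" "U \<subseteq> X"
  shows "arcs_from_to X Y = arcs_from_to (X - U) Y + arcs_from_to U Y"
  unfolding arcs_from_to_def using assms by (simp add: sum.subset_diff)

lemma arcs_from_to_split_right:
  assumes "finite X" "finite Y" "U \<subseteq> Y"
  shows "arcs_from_to X Y = arcs_from_to X (Y - U) + arcs_from_to X U"
  using assms arcs_from_to_split_left[of Y U X]
  by (metis arcs_from_to_commute finite_Diff finite_subset)

text \<open>The degrees in \<open>U\<close> count each arc inside \<open>U\<close> once and each
  crossing edge once. Doubling them accounts for both directions of the crossing edges, but for the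
  arcs inside \<open>U\<close> once too often, which \<open>degree_sum U\<close> on the right
  corrects.\<close>

lemma degree_sum_Diff:
  assumes "finite V" "U \<subseteq> V"
  shows "degree_sum (V - U) + 2 * (\<Sum>u\<in>U. card (nbrs V u)) = degree_sum V + degree_sum U"
proof -
  have fin: "finite U"
    using assms finite_subset by blast
  have "degree_sum V = arcs_from_to (V - U) V + arcs_from_to U V"
    using arcs_from_to_split_left[OF assms] by (simp add: degree_sum_def)
  moreover have "arcs_from_to (V - U) V = degree_sum (V - U) + arcs_from_to (V - U) U"
    using arcs_from_to_split_right[of "V - U" V U] assms by (simp add: degree_sum_def)
  moreover have "arcs_from_to U V = arcs_from_to U (V - U) + degree_sum U"
    using arcs_from_to_split_right[of U V U] assms fin by (simp add: degree_sum_def)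
  moreover have "arcs_from_to U (V - U) = arcs_from_to (V - U) U"
    using arcs_from_to_commute assms fin by simp
  ultimately show ?thesis
    by (simp add: arcs_from_to_def)
qed

lemma degree_sum_remove_vertex:
  assumes "finite V" "v \<in> V"
  shows "degree_sum (V - {v}) + 2 * card (nbrs V v) = degree_sum V"
proof -
  have "degree_sum {v} = 0"
    by (auto simp: degree_sum_def arcs_from_to_def nbrs_def adj_irrefl)
  then show ?thesis
    using degree_sum_Diff[of V "{v}"] assms by simp
qed

text \<open>The arcs between \<open>v\<close> and \<open>N\<close> contribute
  \<open>2 * card N\<close> to the degree sum of the closed neighbourhood; this cancels the term of
  \<open>v\<close> in the sum of the deleted degrees.\<close>

lemma degree_sum_remove_closed_nbrs:
  assumes "finite V" "v \<in> V"
  defines "N \<equiv> nbrs V v"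
  shows "degree_sum (V - insert v N) + 2 * (\<Sum>w\<in>N. card (nbrs V w)) = degree_sum V + degree_sum N"
proof -
  have v: "v \<notin> N" and finN: "finite N" and sub: "insert v N \<subseteq> V"
    using assms adj_irrefl by (auto simp: N_def nbrs_def)
  have nb: "nbrs (insert v N) v = N"
    by (auto simp: N_def nbrs_def adj_irrefl)
  have "degree_sum (insert v N - {v}) + 2 * card (nbrs (insert v N) v) = degree_sum (insert v N)"
    by (rule degree_sum_remove_vertex) (use finN in auto)
  then have "degree_sum (insert v N) = degree_sum N + 2 * card N"
    using v nb by simp
  moreover have "degree_sum (V - insert v N) + 2 * (\<Sum>u\<in>insert v N. card (nbrs V u))
      = degree_sum V + degree_sum (insert v N)"
    by (rule degree_sum_Diff) (use assms sub in auto)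
  ultimately show ?thesis
    using v finN by (simp add: N_def)
qed

text \<open>Each \<open>w\<close> is reached from each of its neighbours and contributes its degree
  every time.\<close>

lemma sum_nbrs_degree:
  fixes V :: "'a set"
  assumes "finite V"
  shows "(\<Sum>v\<in>V. \<Sum>w\<in>nbrs V v. card (nbrs V w)) = (\<Sum>v\<in>V. card (nbrs V v) ^ 2)"
proof -
  have "(\<Sum>v\<in>V. \<Sum>w\<in>nbrs V v. card (nbrs V w)) = (\<Sum>w\<in>V. \<Sum>v\<in>{v\<in>V. adj v w}. card (nbrs V w))"
    unfolding nbrs_def using assms by (rule sum.swap_restrict) fact
  also have "\<dots> = (\<Sum>w\<in>V. card (nbrs V w) ^ 2)"
  proof (intro sum.cong refl)
    fix w
    have "{v\<in>V. adj v w} = nbrs V w"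
      using adj_sym by (auto simp: nbrs_def)
    then show "(\<Sum>v\<in>{v\<in>V. adj v w}. card (nbrs V w)) = card (nbrs V w) ^ 2"
      by (simp add: power2_eq_square)
  qed
  finally show ?thesis .
qed

text \<open>A maximal independent set is dominating, since a vertex without neighbours in it could
  be added.\<close>

lemma obtain_maximal_indep:
  assumes "finite W"
  obtains S where "S \<subseteq> W" "indep S" "W \<subseteq> S \<union> (\<Union>s\<in>S. nbrs W s)"
proof -
  let ?F = "{S. S \<subseteq> W \<and> indep S}"
  have "finite ?F" "{} \<in> ?F"
    using assms by (auto simp: indep_def)
  then obtain S where S: "S \<in> ?F" "\<And>T. T \<in> ?F \<Longrightarrow> S \<subseteq> T \<Longrightarrow> S = T"
    using finite_has_maximal[of ?F] by (metis (no_types, lifting) empty_iff)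
  have "w \<in> S \<union> (\<Union>s\<in>S. nbrs W s)" if "w \<in> W" for w
  proof (rule ccontr)
    assume *: "w \<notin> S \<union> (\<Union>s\<in>S. nbrs W s)"
    then have "insert w S \<in> ?F"
      using S(1) that adj_sym adj_irrefl by (auto simp: indep_def nbrs_def)
    then show False
      using S(2)[of "insert w S"] * by auto
  qed
  with S(1) show thesis
    using that[of S] by blast
qed

text \<open>By Markov's inequality at least half of the vertices have degree at most twice the
  average d. A maximal independent set \<open>S\<close> among them dominates them, and each member
  covers at most 2d + 1 vertices. Hence n/2 is at most (2d + 1) times the size of \<open>S\<close>;
  the statement is this inequality cleared of the quotient d.\<close>

lemma indep_weak_bound:
  assumes fin: "finite V"
  shows "\<exists>S\<subseteq>V. indep S \<and>
    real (card V) ^ 2 \<le> real (card S) * (4 * real (degree_sum V) + 2 * real (card V))"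
proof -
  define n where "n = real (card V)"
  define m where "m = real (degree_sum V)"
  define W where "W = {v \<in> V. real (card (nbrs V v)) * n \<le> 2 * m}"
  have finW: "finite W" and WV: "W \<subseteq> V"
    using fin by (auto simp: W_def)
  obtain S where S: "S \<subseteq> W" "indep S" "W \<subseteq> S \<union> (\<Union>s\<in>S. nbrs W s)"
    using obtain_maximal_indep[OF finW] .
  have finS: "finite S"
    using S finW finite_subset by blast
  have m_eq: "m = (\<Sum>v\<in>V. real (card (nbrs V v)))"
    by (simp add: m_def degree_sum_def arcs_from_to_def)
  have "2 * m * real (card (V - W)) = (\<Sum>v\<in>V - W. 2 * m)"
    by simp
  also have "\<dots> \<le> (\<Sum>v\<in>V - W. real (card (nbrs V v)) * n)"
    by (intro sum_mono) (auto simp: W_def)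
  also have "\<dots> \<le> (\<Sum>v\<in>V. real (card (nbrs V v)) * n)"
    by (intro sum_mono2) (auto simp: fin n_def)
  also have "\<dots> = m * n"
    by (simp add: m_eq sum_distrib_right)
  finally have 1: "2 * m * real (card (V - W)) \<le> m * n" .
  have "real (card (V - W)) = n - real (card W)"
    using fin WV finW by (simp add: n_def card_Diff_subset of_nat_diff card_mono)
  moreover have "card W \<le> card V"
    using WV fin by (simp add: card_mono)
  \<comment> \<open>The Markov estimate carries a factor \<open>m\<close>, so the edgeless case is
    separate.\<close>
  moreover have "W = V" if "m = 0"
  proof -
    have "card (nbrs V v) = 0" if "v \<in> V" for v
      using \<open>m = 0\<close> that fin by (simp add: m_eq sum_nonneg_eq_0_iff)
    then show ?thesis by (auto simp: W_def m_def)
  qed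
  ultimately have W_ge: "n \<le> 2 * real (card W)"
    using 1 by (cases "m = 0") (auto simp: n_def m_def field_simps)
  have "card W \<le> card (S \<union> (\<Union>s\<in>S. nbrs W s))"
    using S finS finW by (intro card_mono) auto
  also have "\<dots> \<le> card S + (\<Sum>s\<in>S. card (nbrs W s))"
    using card_Un_le[of S "\<Union>s\<in>S. nbrs W s"] card_UN_le[OF finS, of "nbrs W"] by linarith
  also have "\<dots> \<le> card S + (\<Sum>s\<in>S. card (nbrs V s))"
    by (intro add_left_mono sum_mono card_mono) (use fin WV in \<open>auto simp: nbrs_def\<close>)
  finally have "real (card W) \<le> real (card S) + (\<Sum>s\<in>S. real (card (nbrs V s)))"
    by (metis of_nat_add of_nat_le_iff of_nat_sum)
  then have "real (card W) * n \<le> (real (card S) + (\<Sum>s\<in>S. real (card (nbrs V s)))) * n"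
    by (intro mult_right_mono) (auto simp: n_def)
  also have "\<dots> = real (card S) * n + (\<Sum>s\<in>S. real (card (nbrs V s)) * n)"
    by (simp add: algebra_simps sum_distrib_left)
  also have "\<dots> \<le> real (card S) * n + (\<Sum>s\<in>S. 2 * m)"
    using S(1) by (intro add_left_mono sum_mono) (auto simp: W_def)
  finally have "real (card W) * n \<le> real (card S) * (2 * m + n)"
    by (simp add: algebra_simps)
  moreover have "n * n \<le> 2 * real (card W) * n"
    using W_ge by (intro mult_right_mono) (auto simp: n_def)
  ultimately have "n ^ 2 \<le> real (card S) * (4 * m + 2 * n)"
    by (simp add: power2_eq_square algebra_simps)
  then show ?thesis
    using S WV by (auto simp: n_def m_def)
qed

section \<open>Triangles in graphs without a complete tripartite subgraph\<close>

definition bicliques :: "nat \<Rightarrow> 'a set \<Rightarrow> ('a set \<times> 'a set) set" where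
  "bicliques t V =
     {(B, T). B \<subseteq> V \<and> T \<subseteq> V \<and> card B = t \<and> card T = t \<and> complete_between B T}"

lemma finite_bicliques:
  assumes "finite V"
  shows "finite (bicliques t V)"
  by (rule finite_subset[of _ "Pow V \<times> Pow V"]) (use assms in \<open>auto simp: bicliques_def\<close>)

text \<open>Choose \<open>b\<close> in \<open>B\<close>, then \<open>x\<close> in \<open>T\<close>
  among the neighbours of \<open>b\<close>. The other \<open>s\<close> elements of \<open>T\<close>
  are neighbours of \<open>b\<close>, those of \<open>B\<close> are neighbours of \<open>x\<close>;
  this leaves 1 + s + s choices among at most \<open>D\<close> vertices each.\<close>

lemma card_bicliques_le:
  assumes fin: "finite V" and deg: "\<And>v. v \<in> V \<Longrightarrow> card (nbrs V v) \<le> D"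
  shows "card (bicliques (Suc s) V) \<le> card V * D ^ (2 * s + 1)"
proof -
  let ?sub = "\<lambda>x. {T. T \<subseteq> nbrs V x \<and> card T = s}"
  let ?X = "SIGMA b:V. SIGMA x:nbrs V b. ?sub b \<times> ?sub x"
  have fin_sub: "finite (?sub x)" for x
    by (rule finite_subset[of _ "Pow (nbrs V x)"]) (use fin in auto)
  have card_sub: "card (?sub x) \<le> D ^ s" if "x \<in> V" for x
  proof -
    have "card (?sub x) = card (nbrs V x) choose s"
      by (rule n_subsets) (use fin in simp)
    also have "\<dots> \<le> card (nbrs V x) ^ s"
      by (cases "s \<le> card (nbrs V x)") (auto simp: binomial_le_pow binomial_eq_0)
    also have "\<dots> \<le> D ^ s"
      using deg[OF that] by (rule power_mono) simp
    finally show ?thesis .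
  qed
  have finX: "finite ?X"
    using fin fin_sub by auto
  have "bicliques (Suc s) V \<subseteq> (\<lambda>(b, x, T, B). (insert b B, insert x T)) ` ?X"
  proof
    fix p assume "p \<in> bicliques (Suc s) V"
    then obtain B T where p: "p = (B, T)" and BT: "B \<subseteq> V" "T \<subseteq> V" "card B = Suc s" "card T = Suc s"
      and compl: "complete_between B T"
      by (auto simp: bicliques_def)
    obtain b where b: "b \<in> B"
      using BT(3) by fastforce
    obtain x where x: "x \<in> T"
      using BT(4) by fastforce
    have "T - {x} \<in> ?sub b" "B - {b} \<in> ?sub x" "x \<in> nbrs V b" "b \<in> V"
      using BT b x compl by (auto simp: complete_between_def nbrs_def intro: adj_sym)
    then have "(b, x, T - {x}, B - {b}) \<in> ?X"
      by simp
    moreover have "p = (\<lambda>(b, x, T, B). (insert b B, insert x T)) (b, x, T - {x}, B - {b})"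
      using b x by (simp add: p insert_absorb)
    ultimately show "p \<in> (\<lambda>(b, x, T, B). (insert b B, insert x T)) ` ?X"
      by (rule rev_image_eqI)
  qed
  then have "card (bicliques (Suc s) V) \<le> card ?X"
    using finX by (rule surj_card_le[rotated])
  also have "\<dots> = (\<Sum>b\<in>V. \<Sum>x\<in>nbrs V b. card (?sub b) * card (?sub x))"
    using fin fin_sub by (simp add: card_cartesian_product)
  also have "\<dots> \<le> (\<Sum>b\<in>V. \<Sum>x\<in>nbrs V b. D ^ s * D ^ s)"
    by (intro sum_mono mult_mono card_sub) (auto simp: nbrs_def)
  also have "\<dots> \<le> (\<Sum>b\<in>V. D * (D ^ s * D ^ s))"
    using deg by (intro sum_mono) simp
  also have "\<dots> = card V * D ^ (2 * s + 1)"
    by (simp add: power_add mult_2)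
  finally show ?thesis .
qed

definition stars :: "nat \<Rightarrow> 'a set \<Rightarrow> ('a \<times> 'a set) set" where
  "stars t V = (SIGMA a:V. {T. T \<subseteq> nbrs V a \<and> card T = t})"

lemma finite_stars: "finite V \<Longrightarrow> finite (stars t V)"
  by (auto simp: stars_def)

lemma card_stars_le:
  assumes fin: "finite V" and deg: "\<And>v. v \<in> V \<Longrightarrow> card (nbrs V v) \<le> D"
  shows "card (stars t V) \<le> card V * D ^ t"
proof -
  have "card (nbrs V v) choose t \<le> D ^ t" if "v \<in> V" for v
  proof -
    have "card (nbrs V v) choose t \<le> card (nbrs V v) ^ t"
      by (cases "t \<le> card (nbrs V v)") (auto simp: binomial_le_pow binomial_eq_0)
    also have "\<dots> \<le> D ^ t"
      using deg[OF that] by (rule power_mono) simp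
    finally show ?thesis .
  qed
  then show ?thesis
    using fin sum_bounded_above[of V "\<lambda>v. card (nbrs V v) choose t" "D ^ t"]
    by (simp add: stars_def n_subsets)
qed

definition common_nbrs :: "'a set \<Rightarrow> 'a \<times> 'a set \<Rightarrow> 'a set" where
  "common_nbrs V = (\<lambda>(a, T). {b \<in> nbrs V a. T \<subseteq> nbrs V b})"

text \<open>Both sides count triples of an arc (a, b) and a t-set \<open>T\<close> of common
  neighbours of its ends, grouped by the arc on the left and by the star (a, T) on the
  right.\<close>

lemma sum_codegree_binomial:
  assumes fin: "finite V"
  shows "(\<Sum>(a, b)\<in>(SIGMA a:V. nbrs V a). card (nbrs (nbrs V a) b) choose t)
    = (\<Sum>p\<in>stars t V. card (common_nbrs V p))"
proof -
  let ?P = "SIGMA a:V. nbrs V a"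
  let ?X = "SIGMA (a, b):?P. {T. T \<subseteq> nbrs (nbrs V a) b \<and> card T = t}"
  let ?Y = "SIGMA p:stars t V. common_nbrs V p"
  have "(\<Sum>(a, b)\<in>?P. card (nbrs (nbrs V a) b) choose t) = card ?X"
    using card_Sigma_subsets[of ?P "\<lambda>(a, b). nbrs (nbrs V a) b" t] fin
    by (simp add: case_prod_beta)
  also have "\<dots> = card ?Y"
    by (rule bij_betw_same_card[of "\<lambda>((a, b), T). ((a, T), b)"],
        rule bij_betw_byWitness[where f' = "\<lambda>((a, T), b). ((a, b), T)"])
       (auto simp: stars_def common_nbrs_def nbrs_def)
  also have "\<dots> = (\<Sum>p\<in>stars t V. card (common_nbrs V p))"
    using fin by (subst card_SigmaI) (auto simp: finite_stars common_nbrs_def)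
  finally show ?thesis .
qed

text \<open>A star (a, T) with a t-set \<open>B\<close> of common neighbours is a biclique (B, T)
  together with a vertex \<open>a\<close> joined to both sides. If more than \<open>t\<close>
  vertices were joined to both sides, \<open>t\<close> of them would form a complete tripartite
  subgraph with \<open>B\<close> and \<open>T\<close>.\<close>

lemma sum_common_nbrs_binomial_le:
  assumes fin: "finite V" and free: "tripartite_free t V"
  shows "(\<Sum>p\<in>stars t V. card (common_nbrs V p) choose t) \<le> card (bicliques t V) * t"
proof -
  let ?X = "SIGMA p:stars t V. {B. B \<subseteq> common_nbrs V p \<and> card B = t}"
  let ?C = "\<lambda>(B, T). {a \<in> V. complete_between {a} B \<and> complete_between {a} T}"
  let ?Y = "SIGMA q:bicliques t V. ?C q"
  have finC: "finite (?C q)" for q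
    using fin by (cases q) simp
  have C_le: "card (?C q) \<le> t" if q_in: "q \<in> bicliques t V" for q
  proof (rule ccontr)
    assume "\<not> card (?C q) \<le> t"
    then have "t \<le> card (?C q)"
      by simp
    then obtain A where A: "A \<subseteq> ?C q" "card A = t"
      by (rule obtain_subset_with_card_n)
    obtain B T where q: "q = (B, T)"
      by (cases q)
    have compl: "complete_between A B" "complete_between A T" and AV: "A \<subseteq> V"
      using A(1) by (auto simp: q complete_between_def)
    have BT: "B \<subseteq> V" "T \<subseteq> V" "card B = t" "card T = t" "complete_between B T"
      using q_in by (auto simp: q bicliques_def)
    show False
      by (rule tripartite_freeD[OF free AV BT(1,2) A(2) BT(3,4) compl BT(5)])
  qed
  have "(\<Sum>p\<in>stars t V. card (common_nbrs V p) choose t) = card ?X"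
    using fin by (intro card_Sigma_subsets[symmetric]) (auto simp: finite_stars common_nbrs_def)
  also have "\<dots> \<le> card ?Y"
  proof (rule card_inj_on_le[of "\<lambda>((a, T), B). ((B, T), a)"])
    show "inj_on (\<lambda>((a, T), B). ((B, T), a)) ?X"
      by (auto simp: inj_on_def)
    have "((B, T), a) \<in> ?Y" if "((a, T), B) \<in> ?X" for a T B
    proof -
      have a: "a \<in> V" and T: "T \<subseteq> nbrs V a" "card T = t" and B: "B \<subseteq> nbrs V a" "card B = t"
        and BT: "\<And>b. b \<in> B \<Longrightarrow> T \<subseteq> nbrs V b"
        using that by (auto simp: stars_def common_nbrs_def)
      have "complete_between {a} B" "complete_between {a} T" "complete_between B T"
        using T(1) B(1) BT by (auto simp: complete_between_def nbrs_def)
      moreover have "B \<subseteq> V" "T \<subseteq> V"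
        using T(1) B(1) nbrs_subset by (blast intro: subset_trans)+
      ultimately show ?thesis
        using a T(2) B(2) by (simp add: bicliques_def)
    qed
    note in_Y = this
    show "(\<lambda>((a, T), B). ((B, T), a)) ` ?X \<subseteq> ?Y"
    proof (rule image_subsetI)
      fix z assume z: "z \<in> ?X"
      obtain a T B where "z = ((a, T), B)"
        using prod.exhaust by metis
      then show "(\<lambda>((a, T), B). ((B, T), a)) z \<in> ?Y"
        using in_Y[of a T B] z by (simp only: prod.case)
    qed
    show "finite ?Y"
      by (intro finite_SigmaI finite_bicliques fin finC)
  qed
  also have "\<dots> = (\<Sum>q\<in>bicliques t V. card (?C q))"
    by (intro card_SigmaI finite_bicliques fin ballI finC)
  also have "\<dots> \<le> card (bicliques t V) * t"
    using sum_bounded_above[of "bicliques t V" "\<lambda>q. card (?C q)" t] C_le by simp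
  finally show ?thesis .
qed

lemma triangle_sum_eq:
  assumes "finite V"
  shows "triangle_sum V = (\<Sum>(a, b)\<in>(SIGMA a:V. nbrs V a). card (nbrs (nbrs V a) b))"
  using assms by (simp add: triangle_sum_def degree_sum_def arcs_from_to_def sum.Sigma)

text \<open>
  A Kovari-Sos-Turan argument in two steps: convexity over the arcs turns many triangles into many
  stars together with a common neighbour of centre and leaves, convexity over the stars turns
  those into many bicliques with a common neighbour.
\<close>

lemma triangle_sum_le:
  fixes D :: nat
  assumes fin: "finite V" and ne: "V \<noteq> {}" and D: "D \<ge> 1" and t: "t > 0"
    and deg: "\<And>v. v \<in> V \<Longrightarrow> card (nbrs V v) \<le> D"
    and free: "tripartite_free t V"
  shows "real (triangle_sum V)
    \<le> real (card V) * (real t * (real t * (real t + 1) + 1)) * real D powr (2 - 1 / real t ^ 2)"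
proof -
  define n where "n = real (card V)"
  define x where "x = real D"
  define \<tau> where "\<tau> = real t"
  have n: "n > 0"
    using fin ne by (simp add: n_def card_gt_0_iff)
  have x: "x \<ge> 1" "x > 0"
    using D by (auto simp: x_def)
  have \<tau>: "\<tau> \<ge> 1"
    using t by (simp add: \<tau>_def)
  have xpow: "x ^ k = x powr real k" for k
    using x by (simp add: powr_realpow)
  obtain s where s: "t = Suc s"
    using t gr0_conv_Suc by blast
  define N where "N = real (\<Sum>p\<in>stars t V. card (common_nbrs V p))"
  \<comment> \<open>With \<open>t = Suc s\<close>, division by the bound \<open>n * x ^ t\<close> on
    the number of stars leaves an average of at most \<open>x ^ s * \<tau>\<close> per star.\<close>
  have "card (bicliques t V) * t \<le> (card V * D ^ (2 * s + 1)) * t"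
    unfolding s by (intro mult_right_mono card_bicliques_le fin deg) auto
  then have "real (\<Sum>p\<in>stars t V. card (common_nbrs V p) choose t) \<le> n * x ^ (2 * s + 1) * \<tau>"
    using sum_common_nbrs_binomial_le[OF fin free] unfolding n_def x_def \<tau>_def
    by (metis (no_types, lifting) of_nat_le_iff of_nat_mult of_nat_power order_trans)
  then have Q: "real (\<Sum>p\<in>stars t V. card (common_nbrs V p) choose t) / (n * x ^ t)
      \<le> n * x ^ (2 * s + 1) * \<tau> / (n * x ^ t)"
    using n x by (intro divide_right_mono) auto
  also have "\<dots> = x ^ s * \<tau>"
    using n x by (simp add: s field_simps power_add mult_2_right)
  finally have Q: "real (\<Sum>p\<in>stars t V. card (common_nbrs V p) choose t) / (n * x ^ t) \<le> x ^ s * \<tau>" .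
  have "real (card (stars t V)) \<le> n * x ^ t"
    using card_stars_le[OF fin deg, of t] unfolding n_def x_def
    by (metis of_nat_le_iff of_nat_mult of_nat_power)
  then have "(N / (n * x ^ t)) ^ t \<le> \<tau> ^ t *
      (real (\<Sum>p\<in>stars t V. card (common_nbrs V p) choose t) / (n * x ^ t) + 1)"
    using average_power_le_average_binomial[of "stars t V" "n * x ^ t" t "\<lambda>p. card (common_nbrs V p)"]
      n x t finite_stars[OF fin] by (simp add: N_def \<tau>_def)
  also have "\<dots> \<le> \<tau> ^ t * (x ^ s * \<tau> + x ^ s)"
    using \<tau> Q x by (intro mult_left_mono add_mono one_le_power) auto
  \<comment> \<open>The constant is enlarged to its t-th power, which makes the whole bound a t-th
    power and the root explicit.\<close>
  also have "\<dots> = \<tau> ^ t * ((\<tau> + 1) ^ 1 * x ^ s)"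
    by (simp add: algebra_simps)
  also have "\<dots> \<le> \<tau> ^ t * ((\<tau> + 1) ^ t * x ^ s)"
    using \<tau> t x by (intro mult_left_mono mult_right_mono power_increasing) auto
  also have "\<dots> = (\<tau> * (\<tau> + 1) * x powr (1 - 1 / \<tau>)) ^ t"
  proof -
    have "(x powr (1 - 1 / \<tau>)) ^ t = x powr (real t * (1 - 1 / \<tau>))"
      using x by (simp add: powr_power)
    also have "real t * (1 - 1 / \<tau>) = real s"
      using \<tau> by (simp add: \<tau>_def s field_simps)
    finally show ?thesis
      by (simp add: power_mult_distrib xpow)
  qed
  finally have "N / (n * x ^ t) \<le> \<tau> * (\<tau> + 1) * x powr (1 - 1 / \<tau>)"
    unfolding s by (rule power_le_imp_le_base) (use \<tau> in auto)
  \<comment> \<open>Passes from the normalisation by stars to the one by arcs, of which there are at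
    most \<open>n * x\<close>.\<close>
  then have "N / (n * x ^ t) * x ^ s \<le> \<tau> * (\<tau> + 1) * x powr (1 - 1 / \<tau>) * x ^ s"
    using x by (intro mult_right_mono) auto
  also have "\<dots> = \<tau> * (\<tau> + 1) * x powr (\<tau> - 1 / \<tau>)"
    using x by (simp add: xpow powr_add[symmetric] \<tau>_def s algebra_simps)
  finally have N: "N / (n * x) \<le> \<tau> * (\<tau> + 1) * x powr (\<tau> - 1 / \<tau>)"
    using n x by (simp add: s)
  \<comment> \<open>This absorbs the additive 1 in the second use of convexity.\<close>
  have one: "1 \<le> x powr (\<tau> - 1 / \<tau>)"
  proof (rule ge_one_powr_ge_zero)
    have "1 / \<tau> \<le> 1"
      using \<tau> by simp
    then show "0 \<le> \<tau> - 1 / \<tau>"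
      using \<tau> by linarith
  qed (rule x(1))
  let ?P = "SIGMA a:V. nbrs V a"
  have "(\<Sum>v\<in>V. card (nbrs V v)) \<le> card V * D"
    using sum_bounded_above[of V "\<lambda>v. card (nbrs V v)" D] deg by simp
  then have "card ?P \<le> card V * D"
    using fin by simp
  then have "real (card ?P) \<le> n * x"
    unfolding n_def x_def by (metis of_nat_le_iff of_nat_mult)
  moreover define c where "c = (\<lambda>(a, b). card (nbrs (nbrs V a) b))"
  moreover have "finite ?P"
    using fin by simp
  ultimately have "(real (\<Sum>p\<in>?P. c p) / (n * x)) ^ t \<le> \<tau> ^ t * (real (\<Sum>p\<in>?P. c p choose t) / (n * x) + 1)"
    using n x t unfolding \<tau>_def by (intro average_power_le_average_binomial) auto
  moreover have "(\<Sum>p\<in>?P. c p) = triangle_sum V"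
    by (simp only: c_def triangle_sum_eq[OF fin])
  moreover have "real (\<Sum>p\<in>?P. c p choose t) = N"
    unfolding N_def sum_codegree_binomial[OF fin, symmetric] c_def by (simp add: case_prod_unfold)
  ultimately have "(real (triangle_sum V) / (n * x)) ^ t \<le> \<tau> ^ t * (N / (n * x) + 1)"
    by simp
  also have "\<dots> \<le> \<tau> ^ t * (\<tau> * (\<tau> + 1) * x powr (\<tau> - 1 / \<tau>) + x powr (\<tau> - 1 / \<tau>))"
    using \<tau> N one by (intro mult_left_mono add_mono) auto
  also have "\<dots> = \<tau> ^ t * ((\<tau> * (\<tau> + 1) + 1) ^ 1 * x powr (\<tau> - 1 / \<tau>))"
    by (simp add: algebra_simps)
  also have "\<dots> \<le> \<tau> ^ t * ((\<tau> * (\<tau> + 1) + 1) ^ t * x powr (\<tau> - 1 / \<tau>))"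
    using \<tau> t by (intro mult_left_mono mult_right_mono power_increasing) auto
  also have "\<dots> = (\<tau> * (\<tau> * (\<tau> + 1) + 1) * x powr (1 - 1 / \<tau> ^ 2)) ^ t"
  proof -
    have "(x powr (1 - 1 / \<tau> ^ 2)) ^ t = x powr (real t * (1 - 1 / \<tau> ^ 2))"
      using x by (simp add: powr_power)
    also have "real t * (1 - 1 / \<tau> ^ 2) = \<tau> - 1 / \<tau>"
      using \<tau> by (simp add: \<tau>_def field_simps power2_eq_square)
    finally show ?thesis
      by (simp add: power_mult_distrib)
  qed
  finally have "real (triangle_sum V) / (n * x) \<le> \<tau> * (\<tau> * (\<tau> + 1) + 1) * x powr (1 - 1 / \<tau> ^ 2)"
    unfolding s by (rule power_le_imp_le_base) (use \<tau> in auto)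
  then have "real (triangle_sum V) \<le> \<tau> * (\<tau> * (\<tau> + 1) + 1) * x powr (1 - 1 / \<tau> ^ 2) * (n * x)"
    using n x by (simp add: divide_le_eq)
  also have "\<dots> = n * (\<tau> * (\<tau> * (\<tau> + 1) + 1)) * (x powr (1 - 1 / \<tau> ^ 2) * x powr 1)"
    using x by simp
  also have "x powr (1 - 1 / \<tau> ^ 2) * x powr 1 = x powr (2 - 1 / \<tau> ^ 2)"
    by (simp only: powr_add[symmetric]) simp
  finally show ?thesis
    by (simp add: n_def x_def \<tau>_def)
qed

end

section \<open>The convex function\<close>

text \<open>The value 1 at 0 is the limit there; it is what edgeless subgraphs receive. In the
  notation of the overview, f(x) is c times \<open>log_ratio (x / A) / A\<close>.\<close>

definition log_ratio :: "real \<Rightarrow> real" where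
  "log_ratio y = (if y = 0 then 1 else ln (1 + y) / y)"

lemma log_ratio_le_1: "0 \<le> y \<Longrightarrow> log_ratio y \<le> 1"
  using ln_add_one_self_le_self[of y] by (simp add: log_ratio_def divide_le_eq)

lemma has_real_derivative_ln_ratio:
  fixes y :: real
  assumes "0 < y"
  shows "((\<lambda>y. ln (1 + y) / y) has_real_derivative 1 / (y * (1 + y)) - ln (1 + y) / y ^ 2) (at y within S)"
proof -
  have y: "1 + y > 0"
    using assms by simp
  have "((\<lambda>y. ln (1 + y) / y) has_real_derivative (1 / (1 + y) * y - ln (1 + y)) / (y * y)) (at y within S)"
    by (rule derivative_eq_intros refl | use assms in simp)+
  also have "(1 / (1 + y) * y - ln (1 + y)) / (y * y) = 1 / (y * (1 + y)) - ln (1 + y) / y ^ 2"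
    using assms y by (simp add: diff_divide_distrib power2_eq_square)
  finally show ?thesis .
qed

text \<open>The second derivative is \<open>?N y / y ^ 3\<close>, where \<open>?N\<close> vanishes
  at 0 and has the nonnegative derivative 2 y^2 / (1 + y)^3.\<close>

lemma convex_log_ratio: "convex_on {0<..} (\<lambda>y::real. ln (1 + y) / y)"
proof (rule f''_ge0_imp_convex)
  let ?N = "\<lambda>y::real. 2 * ln (1 + y) - (3 * y ^ 2 + 2 * y) / (1 + y) ^ 2"
  show "convex {0::real<..}"
    by simp
  show "((\<lambda>y. ln (1 + y) / y) has_real_derivative 1 / (y * (1 + y)) - ln (1 + y) / y ^ 2) (at y)"
    if "y \<in> {0<..}" for y :: real
    using that by (simp add: has_real_derivative_ln_ratio)
  show "((\<lambda>y. 1 / (y * (1 + y)) - ln (1 + y) / y ^ 2) has_real_derivative ?N y / y ^ 3) (at y)"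
    if "y \<in> {0<..}" for y :: real
  proof -
    have y: "y > 0" "1 + y > 0"
      using that by auto
    define L where "L = ln (1 + y)"
    have "((\<lambda>y. 1 / (y * (1 + y))) has_real_derivative - ((1 + y) + y) / (y * (1 + y)) ^ 2) (at y)"
      by (rule derivative_eq_intros refl | use y in \<open>simp add: power2_eq_square; fail\<close>)+
    moreover have "((\<lambda>y. ln (1 + y) / y ^ 2) has_real_derivative
        (1 / (1 + y) * y ^ 2 - L * (2 * y)) / (y ^ 2) ^ 2) (at y)"
      unfolding L_def
      by (rule derivative_eq_intros refl | use y in \<open>simp add: power2_eq_square; fail\<close>)+
    ultimately have "((\<lambda>y. 1 / (y * (1 + y)) - ln (1 + y) / y ^ 2) has_real_derivative
        - ((1 + y) + y) / (y * (1 + y)) ^ 2 - (1 / (1 + y) * y ^ 2 - L * (2 * y)) / (y ^ 2) ^ 2) (at y)"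
      by (rule DERIV_diff)
    also have "- ((1 + y) + y) / (y * (1 + y)) ^ 2 - (1 / (1 + y) * y ^ 2 - L * (2 * y)) / (y ^ 2) ^ 2
        = (2 * L - (3 * y ^ 2 + 2 * y) / (1 + y) ^ 2) / y ^ 3"
      using y by (simp add: divide_simps) (simp add: algebra_simps eval_nat_numeral)
    finally show ?thesis
      by (simp add: L_def)
  qed
  show "0 \<le> ?N y / y ^ 3" if "y \<in> {0<..}" for y :: real
  proof -
    have "?N 0 \<le> ?N y"
    proof (rule DERIV_nonneg_imp_nondecreasing[where f = ?N])
      show "0 \<le> y"
        using that by simp
      fix x :: real
      assume x: "0 \<le> x"
      have "(?N has_real_derivative
          2 / (1 + x) - ((6 * x + 2) * (1 + x) ^ 2 - (3 * x ^ 2 + 2 * x) * (2 * (1 + x))) / ((1 + x) ^ 2) ^ 2) (at x)"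
        by (rule derivative_eq_intros refl | use x in \<open>simp add: power2_eq_square; fail\<close>)+
      also have "2 / (1 + x) - ((6 * x + 2) * (1 + x) ^ 2 - (3 * x ^ 2 + 2 * x) * (2 * (1 + x))) / ((1 + x) ^ 2) ^ 2
          = 2 * x ^ 2 / (1 + x) ^ 3"
        using x by (simp add: divide_simps) (simp add: algebra_simps eval_nat_numeral)
      finally show "\<exists>D. (?N has_real_derivative D) (at x) \<and> 0 \<le> D"
        using x by (intro exI[of _ "2 * x ^ 2 / (1 + x) ^ 3"]) auto
    qed
    then show ?thesis
      using that by simp
  qed
qed

text \<open>The difference of the sides vanishes at 0 and has derivative (y / (1 + y))^2. This is
  the tangent inequality for \<open>log_ratio\<close> at the boundary point 0.\<close>

lemma two_ln_le:
  fixes y :: real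
  assumes "0 \<le> y"
  shows "2 * ln (1 + y) \<le> y + y / (1 + y)"
proof -
  let ?P = "\<lambda>y::real. y + y / (1 + y) - 2 * ln (1 + y)"
  have "?P 0 \<le> ?P y"
  proof (rule DERIV_nonneg_imp_nondecreasing[OF assms])
    fix x :: real
    assume x: "0 \<le> x"
    have "(?P has_real_derivative 1 + 1 / (1 + x) ^ 2 - 2 / (1 + x)) (at x)"
      by (rule derivative_eq_intros refl | use x in \<open>simp add: power2_eq_square field_simps\<close>)+
    also have "1 + 1 / (1 + x) ^ 2 - 2 / (1 + x) = (x / (1 + x)) ^ 2"
      using x by (simp add: divide_simps) (simp add: algebra_simps power2_eq_square)
    finally show "\<exists>D. (?P has_real_derivative D) (at x) \<and> 0 \<le> D"
      by (intro exI[of _ "(x / (1 + x)) ^ 2"]) auto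
  qed
  then show ?thesis
    by simp
qed

text \<open>Convexity gives the case of positive \<open>x\<close>. At 0, outside the open interval,
  the tangent takes the value (2 L - d / (1 + d)) / d, which \<open>two_ln_le\<close> bounds by
  1.\<close>

lemma log_ratio_above_tangent:
  assumes "0 < d" "0 \<le> x"
  shows "ln (1 + d) / d + (x - d) * (1 / (d * (1 + d)) - ln (1 + d) / d ^ 2) \<le> log_ratio x"
proof (cases "x = 0")
  case True
  define L where "L = ln (1 + d)"
  have "2 * L \<le> d + d / (1 + d)"
    using two_ln_le[of d] assms by (simp add: L_def)
  then have "(2 * L - d / (1 + d)) / d \<le> 1"
    using assms by (simp add: divide_le_eq)
  moreover have "L / d + (0 - d) * (1 / (d * (1 + d)) - L / d ^ 2) = (2 * L - d / (1 + d)) / d"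
  proof -
    have "1 + d > 0"
      using assms by simp
    then show ?thesis
      using assms by (simp add: divide_simps) (simp add: algebra_simps power2_eq_square)
  qed
  ultimately show ?thesis
    using True by (simp add: log_ratio_def L_def)
next
  case False
  have "(1 / (d * (1 + d)) - ln (1 + d) / d ^ 2) * (x - d) \<le> ln (1 + x) / x - ln (1 + d) / d"
  proof (rule convex_on_imp_above_tangent[OF convex_log_ratio])
    show "((\<lambda>y. ln (1 + y) / y) has_real_derivative 1 / (d * (1 + d)) - ln (1 + d) / d ^ 2)
        (at d within {0<..})"
      by (rule has_real_derivative_ln_ratio) fact
  qed (use assms False in \<open>auto simp: interior_open\<close>)
  then show ?thesis
    using False by (simp add: log_ratio_def algebra_simps)
qed

text \<open>The tangent inequality at \<open>d / A\<close>, multiplied by \<open>n / A\<close>. The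
  result is linear in the order \<open>n\<close> and the degree sum \<open>m\<close>, so it can be
  averaged over deletions; the factor of \<open>m - n * d\<close> is the derivative of ln (1 + x/A)
  / x at \<open>d\<close>.\<close>

lemma scaled_log_ratio_above_tangent:
  fixes A d n m :: real
  assumes A: "0 < A" and d: "0 < d" and n: "0 \<le> n" and m: "0 \<le> m" "n = 0 \<Longrightarrow> m = 0"
  shows "n * ln (1 + d / A) / d - (m - n * d) * ((ln (1 + d / A) - d / (A + d)) / d ^ 2)
    \<le> n * (log_ratio (m / n / A) / A)"
proof (cases "n = 0")
  case False
  define L where "L = ln (1 + d / A)"
  define y where "y = d / A"
  have "L / y + (m / n / A - y) * (1 / (y * (1 + y)) - L / y ^ 2) \<le> log_ratio (m / n / A)"
    using log_ratio_above_tangent[of y "m / n / A"] assms by (simp add: L_def y_def)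
  then have "(L / y + (m / n / A - y) * (1 / (y * (1 + y)) - L / y ^ 2)) * (n / A)
      \<le> log_ratio (m / n / A) * (n / A)"
    using A n by (intro mult_right_mono) auto
  also have "(L / y + (m / n / A - y) * (1 / (y * (1 + y)) - L / y ^ 2)) * (n / A)
      = n * L / d - (m - n * d) * ((L - d / (A + d)) / d ^ 2)"
  proof -
    have "L / y = L * A / d" "1 / (y * (1 + y)) = A ^ 2 / (d * (A + d))" "L / y ^ 2 = L * A ^ 2 / d ^ 2"
      using A d by (simp_all add: y_def field_simps power2_eq_square)
    moreover have "m / n / A - y = (m - n * d) / (n * A)"
      using A n False by (simp add: y_def field_simps)
    moreover define K where "K = 1 / (d * (A + d)) - L / d ^ 2"
    ultimately have "(L / y + (m / n / A - y) * (1 / (y * (1 + y)) - L / y ^ 2)) * (n / A)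
        = (L / d * A + (m - n * d) / (n * A) * (A ^ 2 * K)) * (n / A)"
      by (simp add: right_diff_distrib)
    also have "\<dots> = n * L / d + (m - n * d) * K"
      using A False by (simp add: add_divide_distrib distrib_right power2_eq_square)
    also have "K = - ((L - d / (A + d)) / d ^ 2)"
      using A d by (simp add: K_def diff_divide_distrib power2_eq_square)
    finally show ?thesis by simp
  qed
  finally show ?thesis
    by (simp add: L_def mult.commute)
qed (use m in simp)

text \<open>
  For \<open>f(x) = ln (1 + x/A) / x\<close> this is \<open>f(d) \<le> - 13 d f'(d)\<close>, hence the deletion of a vertex of degree
  at least \<open>7d\<close> does not decrease \<open>n f(d)\<close>.
\<close>

lemma ln_minus_tangent_ge:
  fixes A d :: real
  assumes "0 < A" "A \<le> 5 * d"
  shows "ln (1 + d / A) \<le> 13 * (ln (1 + d / A) - d / (A + d))"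
proof -
  \<comment> \<open>Here ln (1 + d/A) = - ln (1 - z), which is at least z + z^2 / 2. As
    \<open>A \<le> 5 * d\<close> gives z at least 1/6, this is at least 13 z / 12.\<close>
  define z where "z = d / (A + d)"
  have z: "1 / 6 \<le> z" "z < 1"
    using assms by (auto simp: z_def field_simps)
  have "ln (1 - z) \<le> - z - z ^ 2 / 2"
  proof -
    let ?P = "\<lambda>z::real. - z - z ^ 2 / 2 - ln (1 - z)"
    have "?P 0 \<le> ?P z"
    proof (rule DERIV_nonneg_imp_nondecreasing[where f = ?P])
      show "0 \<le> z" using z by simp
      fix x :: real
      assume x: "0 \<le> x" "x \<le> z"
      have x1: "0 < 1 - x"
        using x z by linarith
      have "(?P has_real_derivative - 1 - x + 1 / (1 - x)) (at x)"
        by (rule derivative_eq_intros refl | use x1 in \<open>simp add: field_simps\<close>)+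
      also have "- 1 - x + 1 / (1 - x) = x ^ 2 / (1 - x)"
        using x1 by (simp add: field_simps power2_eq_square)
      finally show "\<exists>D. (?P has_real_derivative D) (at x) \<and> 0 \<le> D"
        using x1 by (intro exI[of _ "x ^ 2 / (1 - x)"]) auto
    qed
    then show ?thesis by simp
  qed
  moreover have "1 - z = inverse (1 + d / A)"
    using assms by (simp add: z_def field_simps)
  moreover have "0 < 1 + d / A"
    using assms by (intro add_pos_nonneg) auto
  ultimately have "z + z ^ 2 / 2 \<le> ln (1 + d / A)"
    by (simp add: ln_inverse)
  moreover have "z \<le> 6 * z ^ 2"
    using z by (simp add: power2_eq_square)
  ultimately have "13 * z \<le> 12 * ln (1 + d / A)"
    by linarith
  then show ?thesis
    by (simp add: z_def)
qed

section \<open>The induction\<close>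

text \<open>The threshold \<open>(A - 2) / 4\<close> is where \<open>4 * d + 2\<close> reaches
  \<open>A\<close>: up to it \<open>indep_weak_bound\<close> yields n / A, which suffices since
  \<open>log_ratio\<close> is at most 1. Above it the two assumptions on \<open>d\<close> serve the
  two deletion steps.\<close>

lemma (in adjacency) exists_large_indep:
  fixes A c \<eta> C :: real
  assumes t: "t > 0" and A: "A \<ge> 10" and c: "0 < c" "c < 1"
  defines "\<eta> \<equiv> 1 / (4 * real t ^ 2)" and "C \<equiv> real t * (real t * (real t + 1) + 1)"
  assumes powr_ge: "\<And>d. (A - 2) / 4 \<le> d \<Longrightarrow> 7 \<le> d powr \<eta>"
    and error_le: "\<And>d. (A - 2) / 4 \<le> d \<Longrightarrow> ln (1 + d) * (2 / d + C * d powr (- 2 * \<eta>)) \<le> 1 - c"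
    and fin: "finite V" and free: "tripartite_free t V"
  shows "\<exists>S\<subseteq>V. indep S \<and>
    c * (real (card V) * (log_ratio (real (degree_sum V) / real (card V) / A) / A)) \<le> real (card S)"
  using fin free
proof (induction V rule: finite_psubset_induct)
  case (psubset V)
  note fin = psubset.hyps and free = psubset.prems
  define n where "n = real (card V)"
  define m where "m = real (degree_sum V)"
  define d where "d = m / n"
  define deg where "deg = (\<lambda>v. real (card (nbrs V v)))"
  have \<eta>: "0 < \<eta>" "4 * \<eta> = 1 / real t ^ 2"
    using t by (auto simp: \<eta>_def)
  have C: "C \<ge> 0"
    by (simp add: C_def)
  have m_eq: "m = (\<Sum>v\<in>V. deg v)"
    by (simp add: m_def degree_sum_def arcs_from_to_def deg_def)
  show ?case
  proof (cases "V = {}")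
    case True
    then show ?thesis by (auto simp: indep_def)
  next
    case False
    then have n: "n > 0"
      using fin by (simp add: n_def card_gt_0_iff)
    have m: "m = n * d" "m \<ge> 0" and d0: "d \<ge> 0"
      using n by (auto simp: d_def m_def)
    show ?thesis
    proof (cases "d \<le> (A - 2) / 4")
      case True
      obtain S where S: "S \<subseteq> V" "indep S" and "n ^ 2 \<le> real (card S) * (4 * m + 2 * n)"
        using indep_weak_bound[OF fin] unfolding n_def m_def by blast
      then have "n * n \<le> real (card S) * (4 * d + 2) * n"
        by (simp add: m power2_eq_square algebra_simps)
      then have "n \<le> real (card S) * (4 * d + 2)"
        using n by simp
      also have "\<dots> \<le> real (card S) * A"
        using True by (intro mult_left_mono) auto
      finally have "n / A \<le> real (card S)"
        using A by (simp add: divide_le_eq)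
      moreover have "c * (n * (log_ratio (d / A) / A)) \<le> 1 * (n * (1 / A))"
        using n A c d0 by (intro mult_mono divide_right_mono log_ratio_le_1)
          (auto simp: log_ratio_def)
      ultimately have "c * (n * (log_ratio (d / A) / A)) \<le> real (card S)"
        by simp
      then show ?thesis
        using S by (auto simp: n_def m_def d_def)
    next
      case False
      \<comment> \<open>Both bounds on \<open>d\<close> come from \<open>A \<ge> 10\<close>, the
        second because then 5 (A - 2) / 4 is at least \<open>A\<close>.\<close>
      then have large: "(A - 2) / 4 \<le> d" and d: "d \<ge> 2" "A \<le> 5 * d"
        using A by auto
      define M where "M = ln (1 + d / A)"
      define z where "z = d / (A + d)"
      \<comment> \<open>For f(x) = ln (1 + x/A) / x, without the factor \<open>c\<close>, one has M
        = d f(d) and q = - f'(d).\<close>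
      define q where "q = (M - z) / d ^ 2"
      have z: "0 \<le> z" "z \<le> 1"
        using A d by (auto simp: z_def)
      have Mz: "M \<le> 13 * (M - z)"
        using ln_minus_tangent_ge[of A d] A d by (simp add: M_def z_def)
      have M0: "0 \<le> M"
        using A d by (simp add: M_def)
      have q0: "0 \<le> q"
        using Mz M0 by (simp add: q_def)
      have target: "c * (n * (log_ratio (d / A) / A)) = c * (n * M / d)"
        using A d by (simp add: log_ratio_def M_def)
      \<comment> \<open>The induction hypothesis, weakened to the tangent at the average degree
        \<open>d\<close> of the whole graph.\<close>
      have IH: "\<exists>S\<subseteq>U. indep S \<and> c * (real (card U) * M / d - (real (degree_sum U) - real (card U) * d) * q)
          \<le> real (card S)" if "U \<subset> V" for U
      proof -
        have "finite U"
          using that fin finite_subset by blast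
        then have "card U = 0 \<Longrightarrow> degree_sum U = 0"
          by (simp add: degree_sum_def arcs_from_to_def)
        then have "real (card U) * M / d - (real (degree_sum U) - real (card U) * d) * q
            \<le> real (card U) * (log_ratio (real (degree_sum U) / real (card U) / A) / A)"
          unfolding M_def q_def z_def using A d by (intro scaled_log_ratio_above_tangent) auto
        then have "c * (real (card U) * M / d - (real (degree_sum U) - real (card U) * d) * q)
            \<le> c * (real (card U) * (log_ratio (real (degree_sum U) / real (card U) / A) / A))"
          using c by (intro mult_left_mono) auto
        moreover have "tripartite_free t U"
          using tripartite_free_subset[OF free] that by blast
        ultimately show ?thesis
          using psubset.IH[OF that] order_trans by blast
      qed
      have goal: ?thesis if "S \<subseteq> V" "indep S" "c * (n * M / d) \<le> real (card S)" for S
        using that target by (auto simp: n_def m_def d_def)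
      show ?thesis
      proof (cases "\<exists>v\<in>V. d powr (1 + \<eta>) \<le> deg v")
        case True
        then obtain v where v: "v \<in> V" "d powr (1 + \<eta>) \<le> deg v"
          by blast
        have "7 * d \<le> d powr \<eta> * d powr 1"
          using powr_ge[OF large] d by (simp add: mult_right_mono)
        also have "\<dots> = d powr (1 + \<eta>)"
          by (simp only: powr_add[symmetric] add.commute)
        also note v(2)
        finally have deg_v: "7 * d \<le> deg v" .
        obtain S where S: "S \<subseteq> V - {v}" "indep S"
          and S_ge: "c * (real (card (V - {v})) * M / d
            - (real (degree_sum (V - {v})) - real (card (V - {v})) * d) * q) \<le> real (card S)"
          using IH[of "V - {v}"] v(1) by blast
        have "real (card (V - {v})) = n - 1"
          using v(1) fin n by (simp add: n_def of_nat_diff)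
        moreover have "real (degree_sum (V - {v})) = m - 2 * deg v"
          using degree_sum_remove_vertex[OF fin v(1)] by (simp add: m_def deg_def)
        ultimately have "c * ((n - 1) * M / d - (m - 2 * deg v - (n - 1) * d) * q) \<le> real (card S)"
          using S_ge by simp
        \<comment> \<open>The deletion costs M / d and gains (2 deg v - d) q. Since deg v is at
          least 7d, the gain is at least 13 d q, which matches the constant in
          \<open>Mz\<close>.\<close>
        moreover have "n * M / d \<le> (n - 1) * M / d - (m - 2 * deg v - (n - 1) * d) * q"
        proof -
          have "M / d \<le> 13 * (M - z) / d"
            using Mz d by (intro divide_right_mono) auto
          also have "\<dots> = (13 * d) * q"
            using d by (simp add: q_def power2_eq_square)
          also have "\<dots> \<le> (2 * deg v - d) * q"
            using deg_v q0 by (intro mult_right_mono) auto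
          finally show ?thesis
            using d by (simp add: m algebra_simps diff_divide_distrib)
        qed
        ultimately have "c * (n * M / d) \<le> real (card S)"
          using c by (meson mult_le_cancel_left_pos order_trans)
        with S show ?thesis
          by (intro goal[of S]) auto
      next
        case False
        then have deg_less: "deg v < d powr (1 + \<eta>)" if "v \<in> V" for v
          using that by (auto simp: not_le)
        define D where "D = nat \<lfloor>d powr (1 + \<eta>)\<rfloor>"
        have "1 \<le> d powr (1 + \<eta>)"
          using d \<eta> by (intro ge_one_powr_ge_zero) auto
        then have D: "1 \<le> D" "real D \<le> d powr (1 + \<eta>)"
          by (auto simp: D_def le_nat_iff le_floor_iff)
        have deg_D: "card (nbrs V v) \<le> D" if "v \<in> V" for v
          using deg_less[OF that] by (simp add: D_def deg_def le_nat_iff le_floor_iff)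
        have exp_pos: "0 \<le> 2 - 4 * \<eta>"
        proof -
          have "1 \<le> real t ^ 2"
            using t by simp
          then have "1 / real t ^ 2 \<le> 1"
            using t by (simp add: divide_le_eq)
          then show ?thesis
            unfolding \<eta>(2) by linarith
        qed
        have "real (triangle_sum V) \<le> n * C * real D powr (2 - 4 * \<eta>)"
          using triangle_sum_le[OF fin \<open>V \<noteq> {}\<close> D(1) t deg_D free] by (simp add: n_def C_def \<eta>(2))
        also have "\<dots> \<le> n * C * (d powr (1 + \<eta>)) powr (2 - 4 * \<eta>)"
          using n C D exp_pos by (intro mult_left_mono powr_mono2) auto
        also have "\<dots> = n * C * d powr ((1 + \<eta>) * (2 - 4 * \<eta>))"
          by (simp add: powr_powr)
        also have "\<dots> \<le> n * C * d powr (2 + - 2 * \<eta>)"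
        proof -
          \<comment> \<open>The choice of \<open>\<eta>\<close> makes the saving 4
            \<open>\<eta>\<close> in the triangle exponent outweigh the loss 2 \<open>\<eta>\<close>
            from the degree bound.\<close>
          have "(1 + \<eta>) * (2 - 4 * \<eta>) = 2 + - 2 * \<eta> - 4 * \<eta> ^ 2"
            by (simp add: algebra_simps power2_eq_square)
          also have "\<dots> \<le> 2 + - 2 * \<eta>"
            by simp
          finally show ?thesis
            using n C d by (intro mult_left_mono powr_mono) auto
        qed
        also have "\<dots> = n * (C * d powr (- 2 * \<eta>)) * d ^ 2"
        proof -
          have "d powr (2 + - 2 * \<eta>) = d ^ 2 * d powr (- 2 * \<eta>)"
            by (subst powr_add) (use d in simp)
          then show ?thesis
            by (simp add: mult_ac)
        qed
        finally have triangles: "real (triangle_sum V) \<le> n * (C * d powr (- 2 * \<eta>)) * d ^ 2" .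
        \<comment> \<open>The loss in the tangent bound when the closed neighbourhood of
          \<open>v\<close> is deleted. Since \<open>v\<close> joins the independent set,
          \<open>c * W v \<le> 1\<close> suffices.\<close>
        define W where "W = (\<lambda>v. (deg v + 1) * M / d
          + (d * (deg v + 1) - 2 * (\<Sum>w\<in>nbrs V v. deg w) + real (degree_sum (nbrs V v))) * q)"
        have "\<exists>v\<in>V. c * W v \<le> 1"
        proof (rule ccontr)
          assume "\<not> ?thesis"
          then have "(\<Sum>v\<in>V. 1) < (\<Sum>v\<in>V. c * W v)"
            using fin \<open>V \<noteq> {}\<close> by (intro sum_strict_mono) auto
          then have contra: "n < c * (\<Sum>v\<in>V. W v)"
            by (simp add: n_def sum_distrib_left)
          \<comment> \<open>Cauchy-Schwarz; the degree squares arise by summing the neighbours'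
            degrees over all \<open>v\<close>.\<close>
          have sq: "n * d ^ 2 \<le> (\<Sum>v\<in>V. deg v ^ 2)"
          proof -
            have "(n * d) ^ 2 \<le> n * (\<Sum>v\<in>V. deg v ^ 2)"
              using sum_squared_le_sum_of_squares[of deg V] unfolding n_def[symmetric] m_eq[symmetric] m(1)
              by (simp add: mult.commute)
            then show ?thesis
              using n by (simp add: power2_eq_square mult.left_commute[of d])
          qed
          have "(\<Sum>v\<in>V. \<Sum>w\<in>nbrs V v. deg w) = (\<Sum>v\<in>V. deg v ^ 2)"
            using arg_cong[OF sum_nbrs_degree[OF fin], of real] by (simp add: deg_def)
          moreover have "(\<Sum>v\<in>V. real (degree_sum (nbrs V v))) = real (triangle_sum V)"
            by (simp add: triangle_sum_def)
          ultimately have "(\<Sum>v\<in>V. W v) = (m + n) * M / d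
              + (d * (m + n) - 2 * (\<Sum>v\<in>V. deg v ^ 2) + real (triangle_sum V)) * q"
            by (simp add: W_def sum.distrib sum_subtractf sum_divide_distrib[symmetric]
                sum_distrib_right[symmetric] sum_distrib_left[symmetric] m_eq n_def)
          also have "\<dots> \<le> (m + n) * M / d
              + (d * (m + n) - 2 * (n * d ^ 2) + n * (C * d powr (- 2 * \<eta>)) * d ^ 2) * q"
            using sq triangles q0 by (intro add_left_mono mult_right_mono) auto
          also have "\<dots> = n * (M + M / d + (1 / d - 1 + C * d powr (- 2 * \<eta>)) * (q * d ^ 2))"
            using d by (simp add: m field_simps power2_eq_square)
          also have "q * d ^ 2 = M - z"
            using d by (simp add: q_def)
          \<comment> \<open>The leading \<open>M\<close> cancels and leaves z, at most 1. This is
            the differential inequality d f(d) + d^2 f'(d) = z behind the choice of f.\<close>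
          also have "n * (M + M / d + (1 / d - 1 + C * d powr (- 2 * \<eta>)) * (M - z))
              = n * (z + M / d + (1 / d + C * d powr (- 2 * \<eta>)) * (M - z))"
            by (simp add: algebra_simps)
          also have "\<dots> \<le> n * (1 + M / d + (1 / d + C * d powr (- 2 * \<eta>)) * M)"
            using n z C d by (intro mult_left_mono add_mono mult_left_mono) auto
          also have "\<dots> = n * (1 + M * (2 / d + C * d powr (- 2 * \<eta>)))"
            by (simp add: algebra_simps)
          also have "\<dots> \<le> n * (1 + ln (1 + d) * (2 / d + C * d powr (- 2 * \<eta>)))"
          proof -
            have "d / A \<le> d / 1"
              using A d by (intro divide_left_mono) auto
            then have "M \<le> ln (1 + d)"
              using A d unfolding M_def by (intro ln_mono) (auto intro: add_pos_nonneg)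
            then show ?thesis
              using n C d by (intro mult_left_mono add_left_mono mult_right_mono) auto
          qed
          also have "\<dots> \<le> n * (2 - c)"
            using error_le[OF large] n by (intro mult_left_mono) auto
          finally have "c * (\<Sum>v\<in>V. W v) \<le> c * (n * (2 - c))"
            using c by (intro mult_left_mono) auto
          \<comment> \<open>The error allowance 1 - c is compensated by the factor \<open>c\<close>,
            as c (2 - c) is at most 1.\<close>
          also have "\<dots> = n * (1 - (1 - c) ^ 2)"
            by (simp add: algebra_simps power2_eq_square)
          also have "\<dots> \<le> n"
            using n by simp
          finally show False
            using contra by simp
        qed
        then obtain v where v: "v \<in> V" "c * W v \<le> 1"
          by blast
        define N where "N = nbrs V v"
        define U where "U = V - insert v N"
        have N: "finite N" "v \<notin> N" "N \<subseteq> V"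
          using fin adj_irrefl by (auto simp: N_def nbrs_def)
        obtain S where S: "S \<subseteq> U" "indep S"
          and S_ge: "c * (real (card U) * M / d - (real (degree_sum U) - real (card U) * d) * q) \<le> real (card S)"
          using IH[of U] v(1) by (auto simp: U_def)
        have "card U = card V - (card N + 1)"
          using N v(1) by (simp add: U_def card_Diff_subset)
        moreover have "card (insert v N) \<le> card V"
          using N v(1) fin by (intro card_mono) auto
        ultimately have card_U: "real (card U) = n - (deg v + 1)"
          using N by (simp add: n_def deg_def N_def of_nat_diff)
        have "real (degree_sum U) + 2 * (\<Sum>w\<in>N. deg w) = m + real (degree_sum N)"
          using arg_cong[OF degree_sum_remove_closed_nbrs[OF fin v(1)], of real]
          by (simp add: U_def N_def m_def deg_def)
        then have deg_U: "real (degree_sum U) - real (card U) * d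
            = d * (deg v + 1) - 2 * (\<Sum>w\<in>N. deg w) + real (degree_sum N)"
          by (simp add: card_U m algebra_simps)
        have "real (card U) * M / d - (real (degree_sum U) - real (card U) * d) * q = n * M / d - W v"
          unfolding deg_U by (simp add: W_def card_U N_def diff_divide_distrib left_diff_distrib)
        then have "c * (n * M / d) \<le> real (card S) + 1"
          using S_ge v(2) by (simp add: right_diff_distrib)
        moreover have "finite S" "v \<notin> S"
          using S fin finite_subset[of S V] by (auto simp: U_def)
        moreover have "indep (insert v S)"
          using S adj_sym adj_irrefl by (auto simp: indep_def U_def N_def nbrs_def)
        ultimately show ?thesis
          using S v(1) by (intro goal[of "insert v S"]) (auto simp: U_def)
      qed
    qed
  qed
qed

section \<open>Translation to digraphs\<close>

text \<open>Bijections from {0, ..., t - 1} to the three parts combine to a map \<open>h\<close>,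
  and the copy is the image of the tripartite graph under \<open>h\<close>. Two vertices of
  different parts have adjacent images, so looplessness makes \<open>h\<close> injective across
  parts.\<close>

lemma contains_copy_complete_tripartiteI:
  assumes G: "pair_graph G"
    and sub: "A \<subseteq> pverts G" "B \<subseteq> pverts G" "C \<subseteq> pverts G"
    and card: "card A = t" "card B = t" "card C = t"
    and AB: "A \<times> B \<subseteq> parcs G" and AC: "A \<times> C \<subseteq> parcs G" and BC: "B \<times> C \<subseteq> parcs G"
  shows "contains_copy (with_proj G) (with_proj (complete_tripartite_graph t))"
proof -
  interpret G: pair_graph G by fact
  have sym: "(u, v) \<in> parcs G \<Longrightarrow> (v, u) \<in> parcs G" for u v
    using G.pair_sym_arcs by (auto simp: symmetric_def dest: symD)
  define P where "P = (\<lambda>i::nat. if i = 0 then A else if i = 1 then B else C)"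
  have P_sub: "P i \<subseteq> pverts G" and P_card: "card (P i) = t" for i
    using sub card by (auto simp: P_def)
  have cross: "(u, v) \<in> parcs G" if "i < 3" "j < 3" "i \<noteq> j" "u \<in> P i" "v \<in> P j" for i j u v
    using that AB AC BC sym by (auto simp: P_def split: if_splits)
  have "\<exists>e. bij_betw e {..<t} (P i)" for i
    using ex_bij_betw_nat_finite[OF finite_subset[OF P_sub G.pair_finite_verts], of i]
    by (simp add: P_card lessThan_atLeast0)
  then obtain e where e: "\<And>i. bij_betw (e i) {..<t} (P i)"
    by metis
  define h where "h = (\<lambda>(i, j). e i j)"
  define K where "K = complete_tripartite_graph t"
  define H where "H = \<lparr>pverts = h ` pverts K, parcs = map_prod h h ` parcs K\<rparr>"
  define hom where "hom = \<lparr>iso_verts = h, iso_arcs = map_prod h h, iso_head = snd, iso_tail = fst\<rparr>"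
  have h_in: "h x \<in> P (fst x)" if "x \<in> pverts K" for x
    using that bij_betwE[OF e] by (cases x) (auto simp: h_def K_def complete_tripartite_graph_def)
  have K_arcs: "parcs K = {(u, v). u \<in> pverts K \<and> v \<in> pverts K \<and> fst u \<noteq> fst v}"
    and K_fst: "x \<in> pverts K \<Longrightarrow> fst x < 3" for x
    by (auto simp: K_def complete_tripartite_graph_def)
  have inj: "inj_on h (pverts K)"
  proof (rule inj_onI)
    fix x y assume x: "x \<in> pverts K" and y: "y \<in> pverts K" and eq: "h x = h y"
    have "fst x = fst y"
    proof (rule ccontr)
      assume "fst x \<noteq> fst y"
      then have "(h x, h y) \<in> parcs G"
        using cross[OF K_fst[OF x] K_fst[OF y]] h_in x y by blast
      then show False
        using eq G.pair_no_loops by fastforce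
    qed
    moreover have "snd x \<in> {..<t}" "snd y \<in> {..<t}"
      using x y by (auto simp: K_def complete_tripartite_graph_def)
    ultimately show "x = y"
      using eq bij_betw_imp_inj_on[OF e[of "fst x"]] by (auto simp: h_def case_prod_unfold prod_eq_iff dest: inj_onD)
  qed
  have "parcs K \<subseteq> pverts K \<times> pverts K"
    by (auto simp: K_arcs)
  then have inj_arcs: "inj_on (map_prod h h) (parcs K)"
    using map_prod_inj_on[OF inj inj] inj_on_subset by blast
  have wfK: "wf_digraph (with_proj K)"
    by unfold_locales (auto simp: K_arcs)
  then interpret K: wf_digraph "with_proj K" .
  have hom: "pre_digraph.digraph_isomorphism (with_proj K) hom"
    using wfK inj inj_arcs by (auto simp: pre_digraph.digraph_isomorphism_def hom_def)
  have H: "app_iso hom (with_proj K) = with_proj H"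
    by (simp add: app_iso_def H_def hom_def with_proj_def)
  \<comment> \<open>The isomorphism is inverted because \<open>contains_copy\<close> asks for one
    from the subgraph to the pattern.\<close>
  have "pre_digraph.digraph_isomorphism (with_proj H) (pre_digraph.inv_iso (with_proj K) hom)"
    using K.digraph_isomorphism_invI[OF hom] by (simp add: H)
  moreover have "with_proj K = app_iso (pre_digraph.inv_iso (with_proj K) hom) (with_proj H)"
    using K.app_iso_inv[OF hom] by (simp add: H)
  ultimately have "digraph_iso (with_proj H) (with_proj K)"
    unfolding digraph_iso_def by blast
  moreover have "subgraph (with_proj H) (with_proj G)"
  proof -
    have "wf_digraph (with_proj H)"
      using K.wf_digraphI_app_iso[OF hom] by (simp add: H)
    moreover have "h ` pverts K \<subseteq> pverts G"
      using h_in P_sub by blast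
    moreover have "map_prod h h ` parcs K \<subseteq> parcs G"
    proof
      fix a assume "a \<in> map_prod h h ` parcs K"
      then obtain x y where "a = (h x, h y)" "x \<in> pverts K" "y \<in> pverts K" "fst x \<noteq> fst y"
        by (auto simp: K_arcs)
      then show "a \<in> parcs G"
        using cross[of "fst x" "fst y" "h x" "h y"] K_fst h_in by simp
    qed
    ultimately show ?thesis
      using G.wf_digraph_axioms by (simp add: subgraph_def compatible_def H_def)
  qed
  ultimately show ?thesis
    unfolding contains_copy_def K_def by blast
qed

section \<open>Choice of the scale and the final estimate\<close>

text \<open>As \<open>d\<close> grows, \<open>d powr \<eta>\<close> tends to infinity and the error
  term to 0, so both bounds hold from some point on; \<open>A\<close> is taken so large that
  \<open>(A - 2) / 4\<close> lies beyond it.\<close>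

lemma exists_base_scale:
  fixes c \<eta> C :: real
  assumes "c < 1" "0 < \<eta>"
  shows "\<exists>A\<ge>10. \<forall>d\<ge>(A - 2) / 4. 7 \<le> d powr \<eta> \<and> ln (1 + d) * (2 / d + C * d powr (- 2 * \<eta>)) \<le> 1 - c"
proof -
  have "filterlim (\<lambda>d. d powr \<eta>) at_top at_top"
    using assms by real_asymp
  then have "\<forall>\<^sub>F d in at_top. 7 \<le> d powr \<eta>"
    by (simp add: filterlim_at_top)
  moreover have "((\<lambda>d. ln (1 + d) * (2 / d + C * d powr (- 2 * \<eta>))) \<longlongrightarrow> 0) at_top"
  proof -
    have "((\<lambda>d::real. ln (1 + d) * (2 / d)) \<longlongrightarrow> 0) at_top"
      by real_asymp
    moreover have "((\<lambda>d::real. C * (ln (1 + d) * d powr (- 2 * \<eta>))) \<longlongrightarrow> C * 0) at_top"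
      using assms by (intro tendsto_mult tendsto_const) real_asymp
    ultimately show ?thesis
      using tendsto_add by (fastforce simp: algebra_simps)
  qed
  then have "\<forall>\<^sub>F d in at_top. ln (1 + d) * (2 / d + C * d powr (- 2 * \<eta>)) < 1 - c"
    using assms by (intro order_tendstoD) auto
  ultimately have "\<forall>\<^sub>F d in at_top. 7 \<le> d powr \<eta> \<and> ln (1 + d) * (2 / d + C * d powr (- 2 * \<eta>)) \<le> 1 - c"
    by eventually_elim auto
  then obtain D where D: "\<And>d. D \<le> d \<Longrightarrow> 7 \<le> d powr \<eta> \<and> ln (1 + d) * (2 / d + C * d powr (- 2 * \<eta>)) \<le> 1 - c"
    unfolding eventually_at_top_linorder by blast
  show ?thesis
  proof (intro exI conjI)
    define A where "A = max 10 (4 * D + 2)"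
    then have A: "10 \<le> A" "4 * D + 2 \<le> A"
      by auto
    show "10 \<le> A"
      by (rule A)
    show "\<forall>d\<ge>(A - 2) / 4. 7 \<le> d powr \<eta> \<and> ln (1 + d) * (2 / d + C * d powr (- 2 * \<eta>)) \<le> 1 - c"
    proof (intro allI impI)
      fix d
      assume "(A - 2) / 4 \<le> d"
      then have "A - 2 \<le> 4 * d"
        by simp
      then have "D \<le> d"
        using A by linarith
      then show "7 \<le> d powr \<eta> \<and> ln (1 + d) * (2 / d + C * d powr (- 2 * \<eta>)) \<le> 1 - c"
        by (rule D)
    qed
  qed
qed

lemma card_le_independence_number:
  assumes "finite (verts G)" "independent_set G S"
  shows "card S \<le> \<alpha> G"
proof -
  have "{card S | S. independent_set G S} \<subseteq> card ` Pow (verts G)"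
    by (auto simp: independent_set_def)
  then have "finite {card S | S. independent_set G S}"
    using assms(1) finite_subset by blast
  then show ?thesis
    unfolding independence_number_def using assms(2) by (intro Max_ge) auto
qed

theorem theorem5p1:
  shows "\<forall>(\<epsilon>::real) > 0. \<forall>t::nat. \<exists>d\<^sub>0::nat. \<forall>d::real. d \<ge> real d\<^sub>0 \<longrightarrow>
    (\<exists>n\<^sub>0::nat. \<forall>n\<ge>n\<^sub>0. \<forall>G :: 'a pair_pre_digraph.
       pair_graph G \<and> card (pverts G) = n \<and> average_degree (with_proj G) = d \<and>
       \<not> contains_copy (with_proj G) (with_proj (complete_tripartite_graph t)) \<longrightarrow>
       real (\<alpha> (with_proj G)) \<ge> (1 - \<epsilon>) * (real n * ln d / d))"
proof (intro allI impI)
  fix \<epsilon> :: real and t :: nat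
  assume \<epsilon>: "\<epsilon> > 0"
  \<comment> \<open>Strictly between \<open>1 - \<epsilon>\<close> and 1, and positive even for
    large \<open>\<epsilon>\<close>; the gap above \<open>1 - \<epsilon>\<close> later absorbs the
    constant \<open>ln A\<close>.\<close>
  define c where "c = 1 - min \<epsilon> 1 / 2"
  define \<eta> where "\<eta> = 1 / (4 * real t ^ 2)"
  define C where "C = real t * (real t * (real t + 1) + 1)"
  have c: "0 < c" "c < 1" "1 - \<epsilon> < c"
    using \<epsilon> by (auto simp: c_def min_def)
  \<comment> \<open>\<open>A\<close> must be fixed before any graph is given, while positivity of
    \<open>t\<close> is only derived from a graph without a copy. For \<open>t = 0\<close> division
    by zero gives \<open>\<eta> = 0\<close>, hence the guard.\<close>
  have "\<exists>A\<ge>10. t > 0 \<longrightarrow> (\<forall>d\<ge>(A - 2) / 4.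
      7 \<le> d powr \<eta> \<and> ln (1 + d) * (2 / d + C * d powr (- 2 * \<eta>)) \<le> 1 - c)"
  proof (cases "t > 0")
    case True
    then show ?thesis
      using exists_base_scale[OF c(2), of \<eta> C] by (simp add: \<eta>_def)
  qed auto
  then obtain A :: real where A: "A \<ge> 10"
    and scale: "\<And>d. t > 0 \<Longrightarrow> (A - 2) / 4 \<le> d \<Longrightarrow> 7 \<le> d powr \<eta>"
      "\<And>d. t > 0 \<Longrightarrow> (A - 2) / 4 \<le> d \<Longrightarrow> ln (1 + d) * (2 / d + C * d powr (- 2 * \<eta>)) \<le> 1 - c"
    by blast
  have "filterlim (\<lambda>d::real. (c - (1 - \<epsilon>)) * ln d) at_top at_top"
    using c by (intro filterlim_tendsto_pos_mult_at_top[OF tendsto_const _ ln_at_top]) auto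
  then have "\<forall>\<^sub>F d in at_top. c * ln A \<le> (c - (1 - \<epsilon>)) * ln d"
    by (simp add: filterlim_at_top)
  then obtain D where D: "\<And>d. D \<le> d \<Longrightarrow> c * ln A \<le> (c - (1 - \<epsilon>)) * ln d"
    unfolding eventually_at_top_linorder by blast
  show "\<exists>d\<^sub>0::nat. \<forall>d::real. d \<ge> real d\<^sub>0 \<longrightarrow>
    (\<exists>n\<^sub>0::nat. \<forall>n\<ge>n\<^sub>0. \<forall>G :: 'a pair_pre_digraph.
       pair_graph G \<and> card (pverts G) = n \<and> average_degree (with_proj G) = d \<and>
       \<not> contains_copy (with_proj G) (with_proj (complete_tripartite_graph t)) \<longrightarrow>
       real (\<alpha> (with_proj G)) \<ge> (1 - \<epsilon>) * (real n * ln d / d))"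
  proof (intro exI[of _ "nat \<lceil>max 1 D\<rceil>"] exI[of _ 0] allI impI, elim conjE)
    fix d :: real and n :: nat and G :: "'a pair_pre_digraph"
    assume d: "real (nat \<lceil>max 1 D\<rceil>) \<le> d" and G: "pair_graph G" and n: "card (pverts G) = n"
      and avg: "average_degree (with_proj G) = d"
      and no_copy: "\<not> contains_copy (with_proj G) (with_proj (complete_tripartite_graph t))"
    have d1: "d \<ge> 1" "d \<ge> D"
      using d by linarith+
    interpret pair_graph G by fact
    interpret adjacency "\<lambda>u v. (u, v) \<in> parcs G"
    proof
      show "(v, u) \<in> parcs G" if "(u, v) \<in> parcs G" for u v
        using that pair_sym_arcs by (auto simp: symmetric_def dest: symD)
      show "(v, v) \<notin> parcs G" for v
        using pair_no_loops by fastforce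
    qed
    \<comment> \<open>For \<open>t = 0\<close> the forbidden graph is empty and every graph contains
      it.\<close>
    have t: "t > 0"
      using no_copy contains_copy_complete_tripartiteI[OF G, of "{}" "{}" "{}" 0] by (cases t) auto
    have free: "tripartite_free t (pverts G)"
      unfolding tripartite_free_def complete_between_def
      using no_copy contains_copy_complete_tripartiteI[OF G] by (metis mem_Sigma_iff subrelI)
    have "card (nbrs (pverts G) v) = out_degree (with_proj G) v" for v
    proof -
      have "out_arcs (with_proj G) v = Pair v ` nbrs (pverts G) v"
        using in_arcsD2 by (auto simp: out_arcs_def nbrs_def)
      then show ?thesis
        by (simp add: out_degree_def card_image inj_on_def)
    qed
    then have deg: "real (degree_sum (pverts G)) / real (card (pverts G)) = d"
      using avg by (simp add: average_degree_def degree_sum_def arcs_from_to_def)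
    obtain S where S: "S \<subseteq> pverts G" "indep S"
      "c * (real (card (pverts G)) * (log_ratio (d / A) / A)) \<le> real (card S)"
      using exists_large_indep[OF t A c(1,2) scale(1)[unfolded \<eta>_def] scale(2)[unfolded \<eta>_def C_def]
          pair_finite_verts free] t unfolding deg by blast
    have "real (card S) \<le> real (\<alpha> (with_proj G))"
      using S pair_finite_verts
      by (intro of_nat_mono card_le_independence_number) (auto simp: independent_set_def indep_def)
    moreover have "(1 - \<epsilon>) * (real n * ln d / d) \<le> c * (real n * (log_ratio (d / A) / A))"
    proof -
      have "(1 - \<epsilon>) * ln d \<le> c * (ln d - ln A)"
        using D[OF d1(2)] by (simp add: algebra_simps)
      also have "\<dots> = c * ln (d / A)"
        using A d1 by (simp add: ln_div)
      also have "\<dots> \<le> c * ln (1 + d / A)"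
        using A d1 c by (intro mult_left_mono ln_mono) auto
      finally have "(1 - \<epsilon>) * ln d * (real n / d) \<le> c * ln (1 + d / A) * (real n / d)"
        using d1 by (intro mult_right_mono) auto
      then show ?thesis
        using A d1 by (simp add: log_ratio_def mult_ac)
    qed
    ultimately show "real (\<alpha> (with_proj G)) \<ge> (1 - \<epsilon>) * (real n * ln d / d)"
      using S(3) unfolding n by linarith
  qed
qed

end
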